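(* There exists a string family on which $\ell = o(\ell_m)$.
   Context: A string family is an infinite set of finite strings of unbounded length; asymptotic notation on a family refers to strings $w$ of the family with $n=|w|\to\infty$ (with constants uniform over the family). $w[i:j]$ denotes the substring of $w$ from position $i$ to position $j$ (positions start at 1). L-systems: an L-system is a tuple $(\Sigma,\varphi,\tau,s,d,n)$, where $\Sigma$ is a finite alphabet, $\varphi:\Sigma^*\to\Sigma^*$ is a non-erasing monoid endomorphism (each rule $a\to\varphi(a)$, $a\in\Sigma$, has $|\varphi(a)|\ge 1$), $\tau:\Sigma^*\to\Sigma^*$ is a coding (a morphism with $|\tau(a)|=1$ for all $a\in\Sigma$), $s\in\Sigma^+$ is the axiom, and $d\ge 0$, $n\ge 1$ are integers. It generates the unique string $\tau(\varphi^d(s))[1:n]$ of length $n$. It is always assumed that $d=n^{O(1)}$ and $|\Sigma|=n^{O(1)}$ (each value fits in an $O(\log n)$-bit word). The size of the L-system is $\sum_{a\in\Sigma}|\varphi(a)|+|s|+|\Sigma|+2$. The measure $\ell(w)$ is the size of the smallest L-system generating $w$. An L-system is prolongable if there is a symbol $a$ such that $s=a$ and $\varphi(a)=ax$ with $x\neq\varepsilon$ (the empty string). $\ell_m(w)$ is the size of the smallest prolongable L-system generating $w$. *)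

theory Defs
  imports Complex_Main "HOL-Library.Landau_Symbols"
begin

text \<open>
  A morphism is represented by its action on letters. The fields \<open>lrule\<close> and \<open>lcoding\<close> are only
  relevant on \<open>lalphabet\<close>.
\<close>

record 'a lsystem =
  lalphabet :: "'a set"
  lrule :: "'a \<Rightarrow> 'a list"
  lcoding :: "'a \<Rightarrow> 'a"
  laxiom :: "'a list"
  ldepth :: nat
  llen :: nat

definition morph :: "('a \<Rightarrow> 'a list) \<Rightarrow> 'a list \<Rightarrow> 'a list" where
  "morph f u = concat (map f u)"

definition is_lsystem :: "'a lsystem \<Rightarrow> bool" where
  "is_lsystem L \<longleftrightarrow>
     finite (lalphabet L) \<and>
     (\<forall>a \<in> lalphabet L. lrule L a \<in> lists (lalphabet L) \<and> lrule L a \<noteq> []) \<and>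
     (\<forall>a \<in> lalphabet L. lcoding L a \<in> lalphabet L) \<and>
     laxiom L \<in> lists (lalphabet L) \<and> laxiom L \<noteq> [] \<and>
     1 \<le> llen L"

definition lexpansion :: "'a lsystem \<Rightarrow> 'a list" where
  "lexpansion L = map (lcoding L) ((morph (lrule L) ^^ ldepth L) (laxiom L))"

text \<open>The length condition is needed because \<^const>\<open>take\<close> silently returns shorter lists.\<close>

definition generates :: "'a lsystem \<Rightarrow> 'a list \<Rightarrow> bool" where
  "generates L w \<longleftrightarrow> llen L \<le> length (lexpansion L) \<and> w = take (llen L) (lexpansion L)"

definition lsize :: "'a lsystem \<Rightarrow> nat" where
  "lsize L = (\<Sum>a \<in> lalphabet L. length (lrule L a)) + length (laxiom L) + card (lalphabet L) + 2"

definition prolongable :: "'a lsystem \<Rightarrow> bool" where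
  "prolongable L \<longleftrightarrow> (\<exists>a x. laxiom L = [a] \<and> lrule L a = a # x \<and> x \<noteq> [])"

text \<open>
  The standing assumption that the depth and the alphabet size are \<open>n\<^bsup>O(1)\<^esup>\<close>, with the hidden
  constant made explicit.
\<close>

definition poly_bounded :: "nat \<Rightarrow> 'a lsystem \<Rightarrow> bool" where
  "poly_bounded c L \<longleftrightarrow>
     ldepth L \<le> c * llen L ^ c \<and> card (lalphabet L) \<le> c * llen L ^ c"

definition ell :: "nat \<Rightarrow> 'a list \<Rightarrow> nat" where
  "ell c w = (LEAST k. \<exists>L. is_lsystem L \<and> poly_bounded c L \<and> generates L w \<and> lsize L = k)"

definition ell_m :: "nat \<Rightarrow> 'a list \<Rightarrow> nat" where
  "ell_m c w =
     (LEAST k. \<exists>L. is_lsystem L \<and> poly_bounded c L \<and> prolongable L \<and> generates L w \<and> lsize L = k)"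

definition string_family :: "'a list set \<Rightarrow> bool" where
  "string_family F \<longleftrightarrow> infinite F \<and> (\<forall>N. \<exists>w \<in> F. N \<le> length w)"

text \<open>Strings \<open>w\<close> of the family with \<open>length w\<close> tending to infinity.\<close>

definition along :: "'a list set \<Rightarrow> 'a list filter" where
  "along F = inf (filtercomap length at_top) (principal F)"

text \<open>
  Sanity checks: over an infinite supply of symbols, the sets whose least elements define
  \<^const>\<open>ell\<close> and \<^const>\<open>ell_m\<close> are nonempty for nonempty strings and \<open>c \<ge> 1\<close>, and
  \<^const>\<open>along\<close> unfolds to the usual asymptotic quantification.
\<close>

lemma prolongable_lsystem_exists:
  fixes w :: "'a list"
  assumes inf: "infinite (UNIV :: 'a set)" and "w \<noteq> []" and c: "1 \<le> c"
  shows "\<exists>L. is_lsystem L \<and> poly_bounded c L \<and> prolongable L \<and> generates L w"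
proof -
  define n where "n = length w"
  have n: "1 \<le> n" using \<open>w \<noteq> []\<close> by (cases w) (auto simp: n_def)
  have "infinite (UNIV - set w)" using inf by (simp add: Diff_infinite_finite)
  then obtain B where B: "finite B" "card B = n - card (set w)" "B \<subseteq> UNIV - set w"
    using infinite_arbitrarily_large by blast
  define A where "A = set w \<union> B"
  have finA: "finite A" using B by (simp add: A_def)
  have cardA: "card A = n"
    using B card_length[of w] unfolding A_def n_def by (subst card_Un_disjoint) auto
  obtain g where g: "bij_betw g {0..<n} A"
    using ex_bij_betw_nat_finite[OF finA] cardA by blast
  define g' where "g' = inv_into {0..<n} g"
  have g'g: "g' (g i) = i" if "i < n" for i
    using g that by (simp add: g'_def bij_betw_def)
  have gA: "g i \<in> A" if "i < n" for i
    using g that by (auto simp: bij_betw_def)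
  have g'A: "g' a < n" if "a \<in> A" for a
    using g that inv_into_into[of a g "{0..<n}"] by (auto simp: g'_def bij_betw_def)
  have wA: "w ! g' a \<in> A" if "a \<in> A" for a
    using g'A[OF that] by (simp add: A_def n_def)
  define L where "L = \<lparr>lalphabet = A,
      lrule = (\<lambda>a. if a = g 0 then map g [0..<n] @ [g 0] else [a]),
      lcoding = (\<lambda>a. w ! g' a), laxiom = [g 0], ldepth = 1, llen = n\<rparr>"
  have ex: "lexpansion L = w @ [w ! 0]"
  proof -
    have "map (\<lambda>i. w ! g' (g i)) [0..<n] = map (\<lambda>i. w ! i) [0..<n]"
      using g'g by simp
    also have "\<dots> = w" by (simp add: n_def map_nth)
    finally show ?thesis using n g'g[of 0]
      by (simp add: lexpansion_def L_def morph_def comp_def)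
  qed
  have "n \<le> n ^ c" using n c by (simp add: self_le_power)
  then have "n \<le> c * n ^ c" using c by (metis mult_le_mono mult_1)
  moreover from this have "1 \<le> c * n ^ c" using n by (rule order_trans[rotated])
  ultimately have "poly_bounded c L"
    unfolding poly_bounded_def L_def lsystem.simps cardA by blast
  moreover have "is_lsystem L"
    using finA gA[of 0] gA n wA by (auto simp: is_lsystem_def L_def)
  moreover have "prolongable L"
    using n by (auto simp: prolongable_def L_def upt_conv_Cons)
  moreover have "generates L w"
    unfolding generates_def ex by (simp add: L_def n_def)
  ultimately show ?thesis by blast
qed

lemma eventually_along:
  "eventually P (along F) \<longleftrightarrow> (\<exists>N. \<forall>w \<in> F. N \<le> length w \<longrightarrow> P w)"
  unfolding along_def eventually_inf_principal eventually_filtercomap eventually_at_top_linorder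
  by (metis (mono_tags, lifting))

lemma smallo_along_iff:
  fixes f g :: "'a list \<Rightarrow> nat"
  shows "(\<lambda>w. real (f w)) \<in> o[along F](\<lambda>w. real (g w)) \<longleftrightarrow>
    (\<forall>e>0. \<exists>N. \<forall>w \<in> F. N \<le> length w \<longrightarrow> real (f w) \<le> e * real (g w))"
  by (simp add: smallo_def eventually_along)

end

theory Submission
  imports Defs
begin

text \<open>
  The family is \<open>0\<^sup>n1\<close> with \<open>n \<ge> 1\<close>. The rules \<open>0 \<rightarrow> 0\<close>, \<open>1 \<rightarrow> 01\<close> generate it from
  the axiom \<open>1\<close> at depth \<open>n\<close>, so its \<open>\<ell>\<close> is bounded. In a prolongable system the iterates of
  the axiom are prefixes of one another, so the sets of letters occurring in them increase and are
  constant from depth \<open>k\<close> on, where \<open>k\<close> is the size of the system. Hence every letter makes its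
  first appearance within the first \<open>k\<^sup>k\<close> positions, and \<open>\<ell>\<^sub>m(0\<^sup>n1)\<close> tends to infinity.
\<close>

lemma morph_Nil [simp]: "morph f [] = []"
  by (simp add: morph_def)

lemma morph_Cons [simp]: "morph f (x # u) = f x @ morph f u"
  by (simp add: morph_def)

lemma morph_append [simp]: "morph f (u @ v) = morph f u @ morph f v"
  by (simp add: morph_def)

lemma set_morph: "set (morph f u) = (\<Union>a\<in>set u. set (f a))"
  by (simp add: morph_def)

lemma length_morph_le:
  assumes "\<And>a. a \<in> set u \<Longrightarrow> length (f a) \<le> k"
  shows "length (morph f u) \<le> k * length u"
  using assms by (induction u) (auto intro!: add_mono)

lemma funpow_morph_append: "(morph f ^^ d) (u @ v) = (morph f ^^ d) u @ (morph f ^^ d) v"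
  by (induction d) auto

text \<open>One rewriting step turns the axiom \<open>[a]\<close> into \<open>a # x\<close>, so the
  iterate at depth \<open>Suc e\<close> is the iterate at depth \<open>e\<close> followed by that of
  \<open>x\<close>.\<close>

lemma prolongable_iterate_prefix:
  assumes "f a = a # x" and "d \<le> e"
  shows "\<exists>y. (morph f ^^ e) [a] = (morph f ^^ d) [a] @ y"
  using assms(2)
proof (induction e rule: dec_induct)
  case base
  show ?case by simp
next
  case (step e)
  have "(morph f ^^ Suc e) [a] = (morph f ^^ e) [a] @ (morph f ^^ e) x"
    using assms(1) funpow_morph_append[where f = f and d = e and u = "[a]" and v = x] by (simp add: funpow_swap1)
  with step.IH show ?case by auto
qed

lemma is_lsystem_length_rule_le:
  assumes "is_lsystem L" and "a \<in> lalphabet L"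
  shows "length (lrule L a) \<le> lsize L"
proof -
  have "length (lrule L a) \<le> (\<Sum>a\<in>lalphabet L. length (lrule L a))"
    using assms by (intro member_le_sum) (auto simp: is_lsystem_def)
  then show ?thesis by (simp add: lsize_def)
qed

lemma is_lsystem_set_iterate_subset:
  assumes "is_lsystem L"
  shows "set ((morph (lrule L) ^^ d) (laxiom L)) \<subseteq> lalphabet L"
proof (induction d)
  case 0
  show ?case using assms by (auto simp: is_lsystem_def)
next
  case (Suc d)
  then show ?case using assms by (fastforce simp: set_morph is_lsystem_def)
qed

lemma is_lsystem_length_iterate_le:
  assumes "is_lsystem L"
  shows "length ((morph (lrule L) ^^ d) (laxiom L)) \<le> lsize L ^ d * length (laxiom L)"
proof (induction d)
  case 0
  show ?case by simp
next
  case (Suc d)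
  have "length ((morph (lrule L) ^^ Suc d) (laxiom L))
      \<le> lsize L * length ((morph (lrule L) ^^ d) (laxiom L))"
    using is_lsystem_set_iterate_subset[OF assms, of d] is_lsystem_length_rule_le[OF assms]
    by (auto intro!: length_morph_le)
  also have "\<dots> \<le> lsize L * (lsize L ^ d * length (laxiom L))"
    using Suc.IH by (rule mult_le_mono2)
  finally show ?case by (simp add: mult.assoc)
qed

text \<open>The letters after a step depend only on the letters before it, so the increasing chain
  of letter sets stops for good at its first repetition. Until then each step adds a letter of the
  alphabet, which can happen at most \<open>card (lalphabet L)\<close> times.\<close>

lemma prolongable_set_iterate_stable:
  assumes L: "is_lsystem L" "prolongable L" and d: "card (lalphabet L) \<le> d"
  shows "set ((morph (lrule L) ^^ d) (laxiom L))
    = set ((morph (lrule L) ^^ card (lalphabet L)) (laxiom L))"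
proof -
  define S where "S d = set ((morph (lrule L) ^^ d) (laxiom L))" for d
  obtain a x where a: "laxiom L = [a]" "lrule L a = a # x"
    using L by (auto simp: prolongable_def)
  have fin: "finite (lalphabet L)" using L by (simp add: is_lsystem_def)
  have mono: "mono S"
  proof (rule monoI)
    fix d e :: nat assume "d \<le> e"
    from prolongable_iterate_prefix[of "lrule L", OF a(2) this] show "S d \<subseteq> S e"
      by (auto simp: S_def a)
  qed
  have sub: "S d \<subseteq> lalphabet L" for d
    using is_lsystem_set_iterate_subset[OF L(1)] by (simp add: S_def)
  have step: "S (Suc d) = (\<Union>a\<in>S d. set (lrule L a))" for d
    by (simp add: S_def set_morph)
  have "finite (range S)"
    using sub by (intro finite_subset[OF _ finite_Pow_iff[THEN iffD2, OF fin]]) auto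
  then have "\<exists>N. (\<forall>n\<le>N. \<forall>m\<le>N. m < n \<longrightarrow> S m \<subset> S n) \<and> (\<forall>n\<ge>N. S N = S n)"
    using mono step by (intro finite_mono_remains_stable_implies_strict_prefix) auto
  then have "S (card (lalphabet L)) = (\<Union>n. S n)"
    using sub fin by (intro finite_mono_strict_prefix_implies_finite_fixpoint) auto
  then have "S d \<subseteq> S (card (lalphabet L))" by blast
  then show ?thesis using monoD[OF mono d] by (auto simp: S_def)
qed

lemma prolongable_first_occurrence_bound:
  assumes L: "is_lsystem L" "prolongable L" and gen: "generates L (u @ [b])" and b: "b \<notin> set u"
  shows "length u < lsize L ^ lsize L"
proof -
  define I where "I d = (morph (lrule L) ^^ d) (laxiom L)" for d
  define m where "m = card (lalphabet L)"
  obtain a x where a: "laxiom L = [a]" "lrule L a = a # x"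
    using L by (auto simp: prolongable_def)
  obtain v where v: "map (lcoding L) (I (ldepth L)) = u @ b # v"
    using gen unfolding generates_def lexpansion_def I_def
    by (metis append.assoc append_Cons append_Nil append_take_drop_id)
  \<comment> \<open>Cutting the depth at \<open>m\<close> loses no letter: a depth up to
    \<open>m\<close> is unchanged, and beyond \<open>m\<close> the letter set is constant.\<close>
  define e where "e = min (ldepth L) m"
  have "set (I (ldepth L)) = set (I e)"
    using prolongable_set_iterate_stable[OF L, of "ldepth L"]
    by (auto simp: e_def I_def m_def min_def)
  then have "b \<in> set (map (lcoding L) (I e))"
    using arg_cong[OF v, of set] by auto
  moreover obtain y where "I (ldepth L) = I e @ y"
    using prolongable_iterate_prefix[of "lrule L", OF a(2), of e "ldepth L"]
    by (auto simp: I_def a e_def)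
  then have "u @ b # v = map (lcoding L) (I e) @ map (lcoding L) y"
    using v by simp
  then have "take (length (I e)) (u @ b # v) = map (lcoding L) (I e)"
    by simp
  ultimately have "b \<in> set (take (length (I e)) (u @ b # v))"
    by simp
  \<comment> \<open>The first \<open>b\<close> stands at index \<open>length u\<close>, so a prefix
    containing \<open>b\<close> is longer than \<open>u\<close>.\<close>
  then have "length u < length (I e)"
    using b by (cases "length (I e) \<le> length u") (auto dest: in_set_takeD)
  \<comment> \<open>The axiom is a single letter, so only the power of the size remains.\<close>
  also have "\<dots> \<le> lsize L ^ e"
    using is_lsystem_length_iterate_le[OF L(1), of e] by (simp add: I_def a)
  also have "\<dots> \<le> lsize L ^ lsize L"
    by (rule power_increasing) (auto simp: e_def m_def lsize_def)
  finally show ?thesis .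
qed

text \<open>A lower bound on a \<open>LEAST\<close> needs a witness attaining it; the infinite
  letter supply guarantees that one exists.\<close>

lemma prolongable_lsystem_attaining_ell_m:
  fixes w :: "'a list"
  assumes "infinite (UNIV :: 'a set)" and "w \<noteq> []" and "1 \<le> c"
  obtains L where "is_lsystem L" "prolongable L" "generates L w" "lsize L = ell_m c w"
proof -
  have "\<exists>k L. is_lsystem L \<and> poly_bounded c L \<and> prolongable L \<and> generates L w \<and> lsize L = k"
    using prolongable_lsystem_exists[OF assms] by blast
  from LeastI_ex[OF this] that show thesis
    unfolding ell_m_def by blast
qed

lemma ell_m_first_occurrence_bound:
  assumes "infinite (UNIV :: 'a set)" and "1 \<le> c" and "(b :: 'a) \<notin> set u"
  shows "length u < ell_m c (u @ [b]) ^ ell_m c (u @ [b])"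
proof -
  obtain L where "is_lsystem L" "prolongable L" "generates L (u @ [b])"
    "lsize L = ell_m c (u @ [b])"
    using prolongable_lsystem_attaining_ell_m[OF assms(1) _ assms(2), of "u @ [b]"] by auto
  with prolongable_first_occurrence_bound[OF this(1-3) assms(3)] show ?thesis by simp
qed

lemma ell_replicate_snoc_le:
  assumes "a \<noteq> b" and "1 \<le> n" and c: "1 \<le> c"
  shows "ell c (replicate n a @ [b]) \<le> 8"
proof -
  define L where "L = \<lparr>lalphabet = {a, b}, lrule = (\<lambda>x. if x = b then [a, b] else [x]),
    lcoding = id, laxiom = [b], ldepth = n, llen = Suc n\<rparr>"
  have fixed: "morph (lrule L) (replicate d a) = replicate d a" for d
    using \<open>a \<noteq> b\<close> by (induction d) (auto simp: L_def)
  have "(morph (lrule L) ^^ d) [b] = replicate d a @ [b]" for d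
  proof (induction d)
    case (Suc d)
    then show ?case
      using fixed[of d] by (simp add: L_def replicate_append_same)
  qed simp
  then have "lexpansion L = replicate n a @ [b]"
    by (simp add: lexpansion_def L_def)
  then have "generates L (replicate n a @ [b])"
    by (simp add: generates_def L_def)
  moreover have "is_lsystem L"
    by (auto simp: is_lsystem_def L_def)
  \<comment> \<open>Depth \<open>n\<close> and alphabet size 2 are both at most
    \<open>Suc n\<close>, the latter by \<open>1 \<le> n\<close>.\<close>
  moreover have "poly_bounded c L"
  proof -
    have "Suc n \<le> Suc n ^ c" using c by (simp add: self_le_power)
    also have "\<dots> \<le> c * Suc n ^ c" using c by simp
    finally show ?thesis
      using \<open>a \<noteq> b\<close> \<open>1 \<le> n\<close> by (simp add: poly_bounded_def L_def)
  qed
  \<comment> \<open>Rules of lengths 1 and 2, an axiom of length 1, two letters and the constant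
    2.\<close>
  moreover have "lsize L = 8"
    using \<open>a \<noteq> b\<close> by (simp add: lsize_def L_def)
  ultimately show ?thesis
    unfolding ell_def by (intro Least_le) blast
qed

theorem lemma5:
  "\<exists>F :: nat list set. string_family F \<and>
     (\<forall>c \<ge> 1. \<forall>c' \<ge> 1. (\<lambda>w. real (ell c w)) \<in> o[along F](\<lambda>w. real (ell_m c' w)))"
proof -
  define W :: "nat \<Rightarrow> nat list" where "W n = replicate (Suc n) 0 @ [1]" for n
  have len: "length (W n) = n + 2" for n
    by (simp add: W_def)
  have "inj W"
    using len by (metis add_right_cancel injI)
  then have "infinite (range W)"
    by (simp add: finite_image_iff)
  moreover have "\<exists>w\<in>range W. N \<le> length w" for N
    using len[of N] by (intro bexI[of _ "W N"]) auto
  ultimately have "string_family (range W)"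
    by (simp add: string_family_def)
  moreover have "(\<lambda>w. real (ell c w)) \<in> o[along (range W)](\<lambda>w. real (ell_m c' w))"
    if "1 \<le> c" and "1 \<le> c'" for c c'
    unfolding smallo_along_iff
  proof (intro allI impI)
    fix e :: real assume "0 < e"
    \<comment> \<open>Since \<open>ell\<close> is at most 8 on the family, it suffices that
      \<open>ell_m\<close> is eventually at least this \<open>M\<close>.\<close>
    obtain M :: nat where "8 / e < real M"
      using reals_Archimedean2 by blast
    then have M: "8 \<le> e * M" "1 \<le> M"
      using \<open>0 < e\<close> by (cases M; simp add: field_simps)+
    \<comment> \<open>\<open>W n\<close> has length \<open>n + 2\<close>, so this threshold gives
      \<open>Suc n\<close>, the number of zeros, at least \<open>M ^ M\<close>.\<close>
    have "real (ell c w) \<le> e * real (ell_m c' w)" if w: "w \<in> range W" "M ^ M + 1 \<le> length w" for w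
    proof -
      obtain n where n: "w = W n" using w by blast
      define K where "K = ell_m c' w"
      have "Suc n < K ^ K"
        using ell_m_first_occurrence_bound[of c' 1 "replicate (Suc n) (0::nat)"] \<open>1 \<le> c'\<close>
        by (simp add: K_def n W_def)
      moreover have "M ^ M \<le> Suc n"
        using w len by (simp add: n)
      ultimately have "M ^ M < K ^ K" by simp
      \<comment> \<open>Monotonicity of the map from \<open>k\<close> to \<open>k ^ k\<close> turns
        the comparison of powers into \<open>M \<le> K\<close>.\<close>
      moreover have "K ^ K \<le> M ^ M" if "K \<le> M"
        using power_mono[OF that, of K] power_increasing[OF that M(2)] by simp
      ultimately have "M \<le> K" by (meson leD nat_le_linear)
      have "real (ell c w) \<le> 8"
        using ell_replicate_snoc_le[of "0::nat" 1 "Suc n" c] \<open>1 \<le> c\<close> by (simp add: n W_def)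
      also have "\<dots> \<le> e * M" by (rule M)
      also have "\<dots> \<le> e * K" using \<open>M \<le> K\<close> \<open>0 < e\<close> by simp
      finally show ?thesis by (simp add: K_def)
    qed
    then show "\<exists>N. \<forall>w\<in>range W. N \<le> length w \<longrightarrow>
        real (ell c w) \<le> e * real (ell_m c' w)"
      by blast
  qed
  ultimately show ?thesis by blast
qed

end
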